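(* Let $(\sigma,\tau)$ be either $(1324,1423)$ or $(1342,1423)$. The generating function $f(x,y;q)=\sum_{n\ge1}v_n(y,q)x^n$ for the joint distribution of the first letter and number of active sites statistics on $\mathcal{S}_n(\sigma,\tau)$ is given by $$f(x,y;q)=\frac{xy(1-q)(1-xq)(1-2xyq)}{(1-2xq)(1-xyq)(1-(xy+1)q+2xyq^2)}+\frac{xyq}{1-(xy+1)q+2xyq^2}A(x,y),$$ where $$A(x,y)=\frac{xy(2-3x-3y+3xy)+xy(x+y-xy)\left(xy+\sqrt{1-6xy+x^2y^2}\right)}{2(1-2x-y+xy)}.$$
   Context: $\mathcal{S}_n(\sigma,\tau)$ is the set of permutations of $[n]$ avoiding both patterns $\sigma,\tau$ (classical pattern avoidance), and $\mathcal{S}_{n,i}(\sigma,\tau)$ is the subset of those whose first letter is $i$. An active site of $\pi\in\mathcal{S}_n(\sigma,\tau)$ is one of the $n+1$ positions (before the first letter, between consecutive letters, or after the last letter) in which a new smallest element $1$ may be inserted, after all letters of $\pi$ have been increased by one, such that the resulting permutation of length $n+1$ still avoids $\sigma$ and $\tau$. Let $u_n(i,j)$ be the number of members of $\mathcal{S}_{n,i}(\sigma,\tau)$ having exactly $j$ active sites; for $n\ge2$ it can be nonzero only if $1\le i\le n$ and $3\le j\le n+1$, and $u_1(1,2)=1$. Put $v_n(i;q)=\sum_{j=3}^{n+1}u_n(i,j)q^{j-2}$ for $n\ge2$, $1\le i\le n$, $v_1(1;q)=1$, and $v_n(y,q)=\sum_{i=1}^n v_n(i;q)y^i$ (so $v_1(y,q)=y$).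 Identities are between formal power series in $x$ (coefficients rational functions of the other variables), and the square root is the power series with constant term $1$. *)

theory Defs
  imports
    "HOL-Library.Sublist"
    "HOL-Combinatorics.Multiset_Permutations"
    "HOL-Computational_Algebra.Computational_Algebra"
begin

text \<open>Permutations of \<open>{1..n}\<close> are written in one-line notation, as elements of
  \<^term>\<open>permutations_of_set {1..n::nat}\<close>.\<close>

definition order_isomorphic :: "nat list \<Rightarrow> nat list \<Rightarrow> bool" where
  "order_isomorphic s t \<longleftrightarrow>
     length s = length t \<and>
     (\<forall>a<length s. \<forall>b<length s. s ! a < s ! b \<longleftrightarrow> t ! a < t ! b)"

definition contains_pattern :: "nat list \<Rightarrow> nat list \<Rightarrow> bool" where
  "contains_pattern w p \<longleftrightarrow> (\<exists>s. subseq s w \<and> order_isomorphic s p)"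

definition avoiders :: "nat \<Rightarrow> nat list \<Rightarrow> nat list \<Rightarrow> nat list set" where
  "avoiders n \<sigma> \<tau> =
     {w \<in> permutations_of_set {1..n}. \<not> contains_pattern w \<sigma> \<and> \<not> contains_pattern w \<tau>}"

definition avoiders_first :: "nat \<Rightarrow> nat \<Rightarrow> nat list \<Rightarrow> nat list \<Rightarrow> nat list set" where
  "avoiders_first n i \<sigma> \<tau> = {w \<in> avoiders n \<sigma> \<tau>. w \<noteq> [] \<and> hd w = i}"

text \<open>Site \<open>k\<close> is the position preceded by exactly \<open>k\<close> letters.\<close>

definition insert_min :: "nat \<Rightarrow> nat list \<Rightarrow> nat list" where
  "insert_min k w = take k (map Suc w) @ 1 # drop k (map Suc w)"

definition active_sites :: "nat list \<Rightarrow> nat list \<Rightarrow> nat list \<Rightarrow> nat set" where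
  "active_sites \<sigma> \<tau> w =
     {k. k \<le> length w \<and> insert_min k w \<in> avoiders (Suc (length w)) \<sigma> \<tau>}"

definition u_num :: "nat list \<Rightarrow> nat list \<Rightarrow> nat \<Rightarrow> nat \<Rightarrow> nat \<Rightarrow> nat" where
  "u_num \<sigma> \<tau> n i j = card {w \<in> avoiders_first n i \<sigma> \<tau>. card (active_sites \<sigma> \<tau> w) = j}"

text \<open>The case \<open>n = 1\<close> is exceptional: the permutation 1 has two active sites and
  contributes \<open>y\<close>. Only \<open>n \<ge> 1\<close> and \<open>1 \<le> i \<le> n\<close> are meaningful.\<close>

definition v_first :: "nat list \<Rightarrow> nat list \<Rightarrow> nat \<Rightarrow> nat \<Rightarrow> 'a \<Rightarrow> 'a::comm_ring_1" where
  "v_first \<sigma> \<tau> n i q =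
     (if n = 1 then 1 else (\<Sum>j=3..n+1. of_nat (u_num \<sigma> \<tau> n i j) * q ^ (j - 2)))"

definition v_poly :: "nat list \<Rightarrow> nat list \<Rightarrow> nat \<Rightarrow> 'a \<Rightarrow> 'a \<Rightarrow> 'a::comm_ring_1" where
  "v_poly \<sigma> \<tau> n y q = (\<Sum>i=1..n. v_first \<sigma> \<tau> n i q * y ^ i)"

definition joint_gf :: "nat list \<Rightarrow> nat list \<Rightarrow> 'a \<Rightarrow> 'a \<Rightarrow> 'a::comm_ring_1 fps" where
  "joint_gf \<sigma> \<tau> y q = Abs_fps (\<lambda>n. if n \<ge> 1 then v_poly \<sigma> \<tau> n y q else 0)"

text \<open>The coefficient field is the field of rational functions in two independent
  indeterminates over the rationals: \<open>q\<close> is the variable of the inner polynomial ring,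
  \<open>y\<close> that of the outer one.\<close>

type_synonym ratfun2 = "rat poly poly fract"

definition y_var :: ratfun2 where
  "y_var = Fract [:0, 1:] 1"

definition q_var :: ratfun2 where
  "q_var = Fract [:[:0, 1:]:] 1"

text \<open>For a series with constant term 1, the square root with constant term 1.\<close>

definition fps_sqrt1 :: "'a::field_char_0 fps \<Rightarrow> 'a fps" where
  "fps_sqrt1 = fps_radical (\<lambda>_ _. 1) 2"

lemma fps_sqrt1_unique:
  fixes a :: "'a::field_char_0 fps"
  assumes "a $ 0 = 1"
  shows "s ^ 2 = a \<and> s $ 0 = 1 \<longleftrightarrow> s = fps_sqrt1 a"
proof -
  have c: "fps_sqrt1 a $ 0 = 1"
    by (simp add: fps_sqrt1_def numeral_2_eq_2)
  have "s ^ 2 = a \<longleftrightarrow> s = fps_sqrt1 a" if "s $ 0 = 1" for s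
    using radical_unique[of "\<lambda>_ _. 1" 1 a s] assms that
    by (simp add: fps_sqrt1_def numeral_2_eq_2)
  with c show ?thesis by blast
qed

definition A_gf :: "'a fps \<Rightarrow> 'a fps \<Rightarrow> 'a::field_char_0 fps" where
  "A_gf x y =
     (x * y * (2 - 3 * x - 3 * y + 3 * x * y)
       + x * y * (x + y - x * y) * (x * y + fps_sqrt1 (1 - 6 * x * y + x ^ 2 * y ^ 2)))
     / (2 * (1 - 2 * x - y + x * y))"

text \<open>All denominators of the generating function have invertible constant term, so that
  \<^term>\<open>(/)\<close> on power series is genuine division.\<close>

lemma one_minus_vars_nonzero: "1 - y_var \<noteq> 0" "1 - q_var \<noteq> 0"
  by (simp_all add: y_var_def q_var_def One_fract_def Zero_fract_def eq_fract one_pCons)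

lemma denominators_unit:
  defines "x \<equiv> (fps_X :: ratfun2 fps)" and "y \<equiv> fps_const y_var" and "q \<equiv> fps_const q_var"
  shows "(2 * (1 - 2 * x - y + x * y)) $ 0 \<noteq> 0"
    and "((1 - 2 * x * q) * (1 - x * y * q) * (1 - (x * y + 1) * q + 2 * x * y * q ^ 2)) $ 0 \<noteq> 0"
    and "(1 - (x * y + 1) * q + 2 * x * y * q ^ 2) $ 0 \<noteq> 0"
  using one_minus_vars_nonzero by (simp_all add: x_def y_def q_def)

end

theory Submission
  imports Defs
begin

text \<open>
  Delete the leading \<open>1\<close> from the two patterns, leaving \<open>p\<close> and \<open>r\<close>, and call a word \<^emph>\<open>good\<close> if
  it avoids both. A new minimum inserted into an avoider \<open>w\<close> can only play the role of the
  letter \<open>1\<close> of a pattern, so a site is active exactly when the part of \<open>w\<close> to its right is good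
  (\<open>active_sites_Cons_1\<close>). Good words are closed under taking suffixes; hence, if \<open>l\<close> is the
  length of the longest good suffix of \<open>w\<close>, there are \<open>l + 1\<close> active sites.

  The good words are the unimodal ones in the first case and the layered ones in the second.
  All that matters about them is that a nonempty good word stays good under insertion of a new minimum
  in exactly two ways: in front, and at one further position. This alone yields, by induction along
  the word, the succession rule (\<open>sum_insertions\<close>): if \<open>w\<close> has parameter \<open>l\<close>, its
  children have parameters \<open>2, 3, \<dots>, l, l + 1, l + 1\<close>. The first letter grows by one,
  except when the minimum is inserted in front, which is possible only for good \<open>w\<close>.

  Marking \<open>w\<close> by \<open>q ^ (l - 1)\<close> turns the rule into the functional equation
  \<open>functional_equation\<close>, which contains \<open>f(q)\<close> and \<open>f(1)\<close>:
  \<open>(1 - (xy + 1) q + 2 x y q\<^sup>2) f(q) = x y q f(1) + \<dots>\<close>. It is proved with an arbitrary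
  power series in \<open>x\<close> in place of \<open>q\<close>. The coefficient of \<open>f(q)\<close> vanishes for the series
  \<open>q = 2 / (1 + xy + sqrt (1 - 6xy + x\<^sup>2y\<^sup>2))\<close>; this determines \<open>f(1) = A(x,y)\<close>
  (\<open>shifted_gf_at_1\<close>), and then the equation for the indeterminate \<open>q\<close> determines \<open>f(q)\<close>.
\<close>

section \<open>Pattern containment under insertion of a new minimum\<close>

lemma order_isomorphic_Nil: "order_isomorphic s [] \<longleftrightarrow> s = []"
  by (auto simp: order_isomorphic_def)

lemma order_isomorphic_Cons:
  "order_isomorphic (x # s) (y # p) \<longleftrightarrow>
     order_isomorphic s p \<and> list_all2 (\<lambda>a b. (x < a \<longleftrightarrow> y < b) \<and> (a < x \<longleftrightarrow> b < y)) s p"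
  by (auto simp: order_isomorphic_def list_all2_conv_all_nth All_less_Suc2)

lemma order_isomorphic_map_Suc: "order_isomorphic (map Suc s) p \<longleftrightarrow> order_isomorphic s p"
  by (auto simp: order_isomorphic_def)

lemma contains_pattern_mono: "contains_pattern v p \<Longrightarrow> subseq v w \<Longrightarrow> contains_pattern w p"
  unfolding contains_pattern_def by (meson subseq_order.order_trans)

lemma contains_pattern_map_Suc: "contains_pattern (map Suc w) p \<longleftrightarrow> contains_pattern w p"
proof
  assume "contains_pattern (map Suc w) p"
  then obtain N where "order_isomorphic (nths (map Suc w) N) p"
    by (auto simp: contains_pattern_def subseq_conv_nths)
  then have "order_isomorphic (nths w N) p"
    by (simp add: nths_map order_isomorphic_map_Suc)
  then show "contains_pattern w p"
    by (auto simp: contains_pattern_def subseq_conv_nths)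
next
  assume "contains_pattern w p"
  then show "contains_pattern (map Suc w) p"
    unfolding contains_pattern_def by (meson order_isomorphic_map_Suc subseq_map)
qed

lemma contains_pattern_length: "contains_pattern w p \<Longrightarrow> length p \<le> length w"
  by (auto simp: contains_pattern_def order_isomorphic_def dest: list_emb_length)

lemma insert_min_Nil: "insert_min k [] = [1]"
  by (simp add: insert_min_def)

lemma insert_min_0: "insert_min 0 w = 1 # map Suc w"
  by (simp add: insert_min_def)

lemma insert_min_Suc_Cons: "insert_min (Suc k) (a # w) = Suc a # insert_min k w"
  by (simp add: insert_min_def)

lemma length_insert_min: "length (insert_min k w) = Suc (length w)"
  by (simp add: insert_min_def)

lemma subseq_insert_min: "subseq (map Suc w) (insert_min k w)"
proof -
  have "subseq (take k (map Suc w) @ drop k (map Suc w)) (insert_min k w)"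
    unfolding insert_min_def by (intro list_emb_append_mono list_emb_Cons) auto
  then show ?thesis by simp
qed

lemma contains_pattern_insert_minI: "contains_pattern w p \<Longrightarrow> contains_pattern (insert_min k w) p"
  using contains_pattern_mono contains_pattern_map_Suc subseq_insert_min by blast

text \<open>
  An occurrence that uses the inserted letter must use it as the letter \<open>1\<close> of the pattern, because
  that is the least letter on both sides; the rest of the pattern then lies to its right.
\<close>

lemma contains_pattern_insert_min_iff:
  assumes pos: "0 \<notin> set w" and gt: "\<forall>x\<in>set p. 1 < x"
  shows "contains_pattern (insert_min k w) (1 # p) \<longleftrightarrow>
           contains_pattern w (1 # p) \<or> contains_pattern (drop k w) p"
proof
  let ?l = "take k (map Suc w)" and ?r = "drop k (map Suc w)"
  have one: "1 \<notin> set ?l" "1 \<notin> set ?r"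
    using pos by (auto dest: in_set_takeD in_set_dropD)
  assume "contains_pattern (insert_min k w) (1 # p)"
  then obtain s where s: "subseq s (?l @ 1 # ?r)" "order_isomorphic s (1 # p)"
    by (auto simp: contains_pattern_def insert_min_def)
  obtain x s' where xs: "s = x # s'"
    using s(2) by (cases s) (auto simp: order_isomorphic_def)
  obtain s1 s2 where s12: "s = s1 @ s2" "subseq s1 ?l" "subseq s2 (1 # ?r)"
    using s(1) by (auto simp: subseq_append_iff)
  show "contains_pattern w (1 # p) \<or> contains_pattern (drop k w) p"
  proof (cases "1 \<in> set s")
    case False
    have "subseq s2 ?r"
      using s12(3) by cases (use False s12(1) in auto)
    then have "subseq s (?l @ ?r)"
      unfolding s12(1) using s12(2) by (rule list_emb_append_mono[rotated])
    then have "contains_pattern (map Suc w) (1 # p)"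
      using s(2) by (auto simp: contains_pattern_def)
    then show ?thesis by (simp add: contains_pattern_map_Suc)
  next
    case True
    have iso: "order_isomorphic s' p"
      and rel: "list_all2 (\<lambda>a b. (x < a \<longleftrightarrow> 1 < b) \<and> (a < x \<longleftrightarrow> b < 1)) s' p"
      using s(2) by (simp_all add: xs order_isomorphic_Cons)
    have "\<forall>a\<in>set s'. x < a"
      using rel gt by (simp add: list_all2_conv_all_nth all_set_conv_all_nth)
    moreover have "x \<in> set (?l @ 1 # ?r)"
      using list_emb_set[OF s(1), of x] xs by auto
    then have "0 < x"
      by (auto dest: in_set_takeD in_set_dropD)
    ultimately have "x = 1" using True xs by auto
    have "s1 = []"
    proof (cases s1)
      case (Cons z zs)
      then have "1 \<in> set s1" using \<open>x = 1\<close> xs s12(1) by auto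
      then have "1 \<in> set ?l" using s12(2) by (auto dest: list_emb_set)
      then show ?thesis using one by simp
    qed simp
    then have "s2 = 1 # s'"
      using s12(1) xs \<open>x = 1\<close> by simp
    then have "subseq s' ?r"
      using s12(3) by simp
    then have "contains_pattern (map Suc (drop k w)) p"
      using iso by (auto simp: contains_pattern_def drop_map)
    then show ?thesis by (simp add: contains_pattern_map_Suc)
  qed
next
  assume "contains_pattern w (1 # p) \<or> contains_pattern (drop k w) p"
  then show "contains_pattern (insert_min k w) (1 # p)"
  proof
    assume "contains_pattern (drop k w) p"
    then obtain s where s: "subseq s (drop k w)" "order_isomorphic s p"
      by (auto simp: contains_pattern_def)
    have pos': "\<forall>a\<in>set s. 0 < a"
    proof
      fix a assume "a \<in> set s"
      with list_emb_set[OF s(1)] have "a \<in> set w" by (blast dest: in_set_dropD)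
      with pos show "0 < a" by (cases a) auto
    qed
    have "subseq (1 # map Suc s) (1 # map Suc (drop k w))"
      using s(1) by (simp add: subseq_map)
    then have "subseq (1 # map Suc s) (insert_min k w)"
      unfolding insert_min_def drop_map by (rule list_emb_append2)
    moreover have "order_isomorphic (1 # map Suc s) (1 # p)"
    proof -
      have "length s = length p" using s(2) by (simp add: order_isomorphic_def)
      then have "list_all2 (\<lambda>a b. 0 < a \<and> 1 < b) s p"
        using gt pos' by (simp add: list_all2_conv_all_nth)
      then have "list_all2 (\<lambda>a b. (1 < a \<longleftrightarrow> 1 < b) \<and> (a < 1 \<longleftrightarrow> b < 1)) (map Suc s) p"
        unfolding list_all2_map1 by (rule list.rel_mono_strong) auto
      then show ?thesis
        using s(2) by (simp only: order_isomorphic_Cons order_isomorphic_map_Suc)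
    qed
    ultimately show ?thesis by (auto simp: contains_pattern_def)
  qed (rule contains_pattern_insert_minI)
qed

definition avoids_both :: "nat list \<Rightarrow> nat list \<Rightarrow> nat list \<Rightarrow> bool" where
  "avoids_both p r u \<longleftrightarrow> \<not> contains_pattern u p \<and> \<not> contains_pattern u r"

lemma avoids_both_subseq: "avoids_both p r w \<Longrightarrow> subseq v w \<Longrightarrow> avoids_both p r v"
  by (auto simp: avoids_both_def dest: contains_pattern_mono)

lemma avoids_both_insert_minD: "avoids_both p r (insert_min k u) \<Longrightarrow> avoids_both p r u"
  by (auto simp: avoids_both_def dest: contains_pattern_insert_minI)

section \<open>The generating tree of avoiders\<close>

lemma avoiders_iff: "w \<in> avoiders n \<sigma> \<tau> \<longleftrightarrow> w \<in> permutations_of_set {1..n} \<and> avoids_both \<sigma> \<tau> w"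
  by (auto simp: avoiders_def avoids_both_def)

lemma finite_avoiders: "finite (avoiders n \<sigma> \<tau>)"
  by (auto simp: avoiders_def)

lemma avoidersD:
  assumes "w \<in> avoiders n \<sigma> \<tau>"
  shows "length w = n" "distinct w" "set w = {1..n}" "0 \<notin> set w"
proof -
  have "w \<in> permutations_of_set {1..n}" using assms by (simp add: avoiders_iff)
  then show "length w = n" "distinct w" "set w = {1..n}" "0 \<notin> set w"
    by (auto dest: permutations_of_setD simp: length_finite_permutations_of_set)
qed

lemma insert_min_permutation:
  assumes "w \<in> permutations_of_set {1..n}"
  shows "insert_min k w \<in> permutations_of_set {1..Suc n}"
proof (rule permutations_of_setI)
  have w: "set w = {1..n}" "distinct w" using assms by (auto dest: permutations_of_setD)
  have "mset (insert_min k w) = mset (1 # map Suc w)"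
    by (metis insert_min_def append_take_drop_id mset.simps(2) mset_append union_mset_add_mset_right)
  then have eq: "set (insert_min k w) = set (1 # map Suc w)"
    "distinct (insert_min k w) = distinct (1 # map Suc w)"
    by (metis set_mset_mset) (metis \<open>mset (insert_min k w) = _\<close> mset_eq_imp_distinct_iff)
  show "set (insert_min k w) = {1..Suc n}"
    unfolding eq using w by (auto simp: image_Suc_atLeastAtMost)
  show "distinct (insert_min k w)"
    unfolding eq using w by (auto simp: distinct_map)
qed

lemma insert_min_inject:
  assumes "insert_min k w = insert_min k' w'" "0 \<notin> set w" "0 \<notin> set w'"
    "k \<le> length w" "k' \<le> length w'"
  shows "k = k' \<and> w = w'"
proof -
  have "takeWhile (\<lambda>x. x \<noteq> 1) (insert_min j v) = take j (map Suc v)" if "0 \<notin> set v" for j v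
    unfolding insert_min_def using that
    by (subst takeWhile_append2) (auto dest!: in_set_takeD)
  from this[OF assms(2)] this[OF assms(3)] have t: "take k (map Suc w) = take k' (map Suc w')"
    using assms(1) by metis
  then have "k = k'"
    using assms(4,5) by (metis length_map length_take min.absorb2)
  moreover have "drop k (map Suc w) = drop k' (map Suc w')"
    using assms(1) t by (simp add: insert_min_def)
  with t have "map Suc w = map Suc w'" by (metis append_take_drop_id)
  then have "w = w'" by (simp add: inj_map_eq_map)
  ultimately show ?thesis by simp
qed

lemma avoiders_Suc_exists:
  assumes "w' \<in> avoiders (Suc n) \<sigma> \<tau>"
  shows "\<exists>w k. w \<in> avoiders n \<sigma> \<tau> \<and> k \<in> active_sites \<sigma> \<tau> w \<and> w' = insert_min k w"
proof -
  note w' = avoidersD[OF assms]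
  have "1 \<in> set w'" using w' by simp
  then obtain ls rs where lr: "w' = ls @ 1 # rs" by (auto dest: split_list)
  define w where "w = map (\<lambda>x. x - 1) (ls @ rs)"
  have one: "1 \<notin> set (ls @ rs)" using w'(2) lr by auto
  have pos: "\<forall>x\<in>set (ls @ rs). 0 < x" using w'(4) lr by (auto intro!: gr0I)
  have "map Suc w = ls @ rs"
    unfolding w_def map_map by (rule map_idI) (use pos in auto)
  then have ins: "insert_min (length ls) w = w'"
    by (simp add: insert_min_def lr)
  have "distinct (map Suc w)" using w'(2) lr \<open>map Suc w = _\<close> by simp
  then have d: "distinct w" by (simp add: distinct_map)
  have "Suc ` set w = set w' - {1}"
    using \<open>map Suc w = _\<close> lr one by (metis (no_types, lifting) Diff_insert_absorb Un_insert_right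
        list.set_map list.simps(15) set_append)
  also have "\<dots> = Suc ` {1..n}"
    unfolding w'(3) image_Suc_atLeastAtMost by auto
  finally have "set w = {1..n}" using inj_image_eq_iff[OF inj_Suc] by blast
  with d have "w \<in> permutations_of_set {1..n}" by (intro permutations_of_setI)
  moreover have "avoids_both \<sigma> \<tau> w"
    using assms ins by (auto simp: avoiders_iff intro: avoids_both_insert_minD)
  ultimately have "w \<in> avoiders n \<sigma> \<tau>" by (simp add: avoiders_iff)
  moreover have "length ls \<le> length w" by (simp add: w_def)
  then have "length ls \<in> active_sites \<sigma> \<tau> w"
    using assms ins avoidersD(1)[OF \<open>w \<in> avoiders n \<sigma> \<tau>\<close>] by (simp add: active_sites_def)
  ultimately show ?thesis using ins by metis
qed

text \<open>
  Every avoider of length \<open>n + 1\<close> arises exactly once from an avoider of length \<open>n\<close>, by undoing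
  the insertion of its letter \<open>1\<close>.
\<close>

lemma sum_avoiders_Suc:
  fixes h :: "nat list \<Rightarrow> 'a::comm_monoid_add"
  shows "(\<Sum>w\<in>avoiders (Suc n) \<sigma> \<tau>. h w) =
    (\<Sum>w\<in>avoiders n \<sigma> \<tau>. \<Sum>k\<in>active_sites \<sigma> \<tau> w. h (insert_min k w))"
proof -
  let ?S = "SIGMA w:avoiders n \<sigma> \<tau>. active_sites \<sigma> \<tau> w"
  have "bij_betw (\<lambda>(w, k). insert_min k w) ?S (avoiders (Suc n) \<sigma> \<tau>)"
  proof (rule bij_betwI')
    fix a b assume "a \<in> ?S" "b \<in> ?S"
    then show "((case a of (w, k) \<Rightarrow> insert_min k w) = (case b of (w, k) \<Rightarrow> insert_min k w)) \<longleftrightarrow> a = b"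
      by (auto simp: active_sites_def dest: avoidersD(4) insert_min_inject)
  next
    fix a assume "a \<in> ?S"
    then show "(case a of (w, k) \<Rightarrow> insert_min k w) \<in> avoiders (Suc n) \<sigma> \<tau>"
      by (auto simp: active_sites_def dest: avoidersD(1))
  next
    fix b assume "b \<in> avoiders (Suc n) \<sigma> \<tau>"
    from avoiders_Suc_exists[OF this]
    show "\<exists>a\<in>?S. b = (case a of (w, k) \<Rightarrow> insert_min k w)" by auto
  qed
  then have "(\<Sum>w\<in>avoiders (Suc n) \<sigma> \<tau>. h w) = (\<Sum>(w, k)\<in>?S. h (insert_min k w))"
    by (subst sum.reindex_bij_betw[symmetric]) (auto simp: case_prod_unfold)
  also have "\<dots> = (\<Sum>w\<in>avoiders n \<sigma> \<tau>. \<Sum>k\<in>active_sites \<sigma> \<tau> w. h (insert_min k w))"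
    by (subst sum.Sigma) (auto simp: finite_avoiders active_sites_def)
  finally show ?thesis .
qed

lemma active_sites_Cons_1:
  assumes w: "w \<in> avoiders n (1 # p) (1 # r)" and gt: "\<forall>x\<in>set p \<union> set r. 1 < x"
  shows "active_sites (1 # p) (1 # r) w = {k. k \<le> length w \<and> avoids_both p r (drop k w)}"
proof -
  have "insert_min k w \<in> avoiders (Suc (length w)) (1 # p) (1 # r) \<longleftrightarrow> avoids_both p r (drop k w)" for k
  proof -
    have "contains_pattern (insert_min k w) (1 # s) \<longleftrightarrow> contains_pattern (drop k w) s"
      if "s = p \<or> s = r" for s
      using contains_pattern_insert_min_iff[OF avoidersD(4)[OF w], of s k] that w gt
      unfolding avoiders_iff avoids_both_def by blast
    moreover have "insert_min k w \<in> permutations_of_set {1..Suc (length w)}"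
      using w insert_min_permutation avoidersD(1)[OF w] unfolding avoiders_iff by blast
    ultimately show ?thesis
      unfolding avoiders_iff avoids_both_def by blast
  qed
  then show ?thesis by (simp add: active_sites_def)
qed

section \<open>The succession rule\<close>

primrec longest_suffix_length :: "(nat list \<Rightarrow> bool) \<Rightarrow> nat list \<Rightarrow> nat" where
  "longest_suffix_length P [] = 0"
| "longest_suffix_length P (a # w) = (if P (a # w) then Suc (length w) else longest_suffix_length P w)"

lemma longest_suffix_le: "longest_suffix_length P w \<le> length w"
  by (induction w) auto

lemma longest_suffix_eq_length: "P w \<Longrightarrow> longest_suffix_length P w = length w"
  by (cases w) auto

lemma longest_suffix_eq_length_iff: "P [] \<Longrightarrow> longest_suffix_length P w = length w \<longleftrightarrow> P w"
  using longest_suffix_le[of P "tl w"] by (cases w) auto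

text \<open>
  What the growth argument needs from the pair of patterns stripped of their leading \<open>1\<close>. Together the
  last two assumptions say that a nonempty good word has exactly two good insertions of a minimum.
\<close>

locale min_insertion =
  fixes p r :: "nat list"
  assumes entries_gt_1: "\<forall>x\<in>set p \<union> set r. 1 < x"
    and pattern_length: "length p = 3" "length r = 3"
    and good_insert_front:
      "\<And>u. distinct u \<Longrightarrow> 0 \<notin> set u \<Longrightarrow> avoids_both p r u \<Longrightarrow> avoids_both p r (insert_min 0 u)"
    and good_insert_unique:
      "\<And>u. distinct u \<Longrightarrow> 0 \<notin> set u \<Longrightarrow> avoids_both p r u \<Longrightarrow> u \<noteq> [] \<Longrightarrow>
         \<exists>!k. 0 < k \<and> k \<le> length u \<and> avoids_both p r (insert_min k u)"
begin

abbreviation good :: "nat list \<Rightarrow> bool" where "good \<equiv> avoids_both p r"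

abbreviation good_len :: "nat list \<Rightarrow> nat" where "good_len \<equiv> longest_suffix_length good"

abbreviation av :: "nat \<Rightarrow> nat list set" where "av n \<equiv> avoiders n (1 # p) (1 # r)"

text \<open>
  For an avoider these are its active sites; unlike active sites they behave well when letters are
  removed from the front of an arbitrary word, which is what the inductions below do.
\<close>

definition sites :: "nat list \<Rightarrow> nat set" where
  "sites w = {k. k \<le> length w \<and> good (drop k w)}"

lemma good_short: "length u \<le> 2 \<Longrightarrow> good u"
  using pattern_length by (auto simp: avoids_both_def dest: contains_pattern_length)

lemma good_Cons: "good (a # u) \<Longrightarrow> good u"
  by (erule avoids_both_subseq) auto

lemma sites_Cons: "sites (a # w) = (if good (a # w) then insert 0 (Suc ` sites w) else Suc ` sites w)"
proof -
  have "k \<in> sites (a # w) \<longleftrightarrow> k \<in> (if good (a # w) then insert 0 (Suc ` sites w) else Suc ` sites w)" for k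
    by (cases k) (auto simp: sites_def)
  then show ?thesis by blast
qed

lemma finite_sites: "finite (sites w)"
  by (simp add: sites_def)

lemma sites_good: "good w \<Longrightarrow> sites w = {..length w}"
proof (induction w)
  case (Cons a w)
  then show ?case using good_Cons by (auto simp: sites_Cons atMost_Suc_eq_insert_0)
qed (auto simp: sites_def)

lemma card_sites: "card (sites w) = Suc (good_len w)"
proof (induction w)
  case (Cons a w)
  show ?case
  proof (cases "good (a # w)")
    case True then show ?thesis by (simp add: sites_good)
  next
    case False
    then show ?thesis using Cons by (simp add: sites_Cons card_image)
  qed
qed (auto simp: sites_def good_short)

lemma good_len_ge: "min 2 (length w) \<le> good_len w"
proof (induction w)
  case (Cons a w)
  show ?case
  proof (cases "good (a # w)")
    case False
    then have "2 \<le> length w" using good_short[of "a # w"] by (cases "2 \<le> length w") auto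
    then show ?thesis using Cons False by simp
  qed auto
qed simp

text \<open>
  The succession rule, with an arbitrary weight \<open>g\<close> so that it can be read as an equality of
  multisets of parameters. A front letter \<open>a\<close> that makes the word bad changes nothing. If \<open>a # w\<close> is
  good with \<open>w\<close> of length \<open>n > 0\<close>, inserting in front of \<open>a\<close> gives the parameter \<open>n + 2\<close>; the other
  insertions are those of \<open>w\<close>, and exactly one of them stays good behind \<open>a\<close>, so one of the two
  parameters \<open>n + 1\<close> of the children of \<open>w\<close> is raised to \<open>n + 2\<close>.
\<close>

lemma sum_insertions:
  fixes g :: "nat \<Rightarrow> 'a::comm_ring_1"
  assumes "distinct w" "0 \<notin> set w" "w \<noteq> []"
  shows "(\<Sum>k\<in>sites w. g (good_len (insert_min k w))) = (\<Sum>t=2..good_len w. g t) + 2 * g (Suc (good_len w))"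
  using assms
proof (induction w)
  case (Cons a w)
  have shift: "(\<Sum>k\<in>Suc ` sites w. g (good_len (insert_min k (a # w)))) =
      (\<Sum>k\<in>sites w. g (good_len (Suc a # insert_min k w)))"
    by (subst sum.reindex) (auto simp: insert_min_Suc_Cons)
  show ?case
  proof (cases "good (a # w)")
    case False
    then have "w \<noteq> []" using good_short[of "[a]"] by auto
    have "\<not> good (Suc a # insert_min k w)" for k
      using False avoids_both_insert_minD[of p r "Suc k" "a # w"] by (auto simp: insert_min_Suc_Cons)
    then show ?thesis
      using Cons False \<open>w \<noteq> []\<close> shift by (simp add: sites_Cons)
  next
    case good: True
    show ?thesis
    proof (cases "w = []")
      case True
      then show ?thesis
        by (simp add: sites_good good_short atMost_Suc insert_min_0 insert_min_Suc_Cons insert_min_Nil)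
    next
      case False
      let ?n = "length w"
      note IH = Cons.IH[OF _ _ False]
      have sw: "sites w = {..?n}" and gw: "good w" and lw: "good_len w = ?n"
        using good good_Cons sites_good longest_suffix_eq_length by blast+
      have "\<exists>!k. 0 < k \<and> k \<le> Suc ?n \<and> good (insert_min k (a # w))"
        using good_insert_unique[OF Cons.prems(1,2) good] by simp
      then obtain k0 where k0: "0 < k0 \<and> k0 \<le> Suc ?n \<and> good (insert_min k0 (a # w))"
        and uniq: "\<forall>k. 0 < k \<and> k \<le> Suc ?n \<and> good (insert_min k (a # w)) \<longrightarrow> k = k0"
        by (elim ex1E) metis
      \<comment> \<open>\<open>m\<close> is the one insertion into \<open>w\<close> that stays good behind \<open>a\<close>\<close>
      obtain m where m: "k0 = Suc m" using k0 by (cases k0) auto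
      have m_le: "m \<le> ?n" and gm: "good (Suc a # insert_min m w)"
        using k0 m by (auto simp: insert_min_Suc_Cons)
      have bad: "\<not> good (Suc a # insert_min k w)" if "k \<le> ?n" "k \<noteq> m" for k
        using uniq[rule_format, of "Suc k"] that m by (auto simp: insert_min_Suc_Cons)
      have lm: "good_len (insert_min m w) = Suc ?n"
        using good_Cons[OF gm] by (simp add: longest_suffix_eq_length length_insert_min)
      have "(\<Sum>k\<in>sites (a # w). g (good_len (insert_min k (a # w)))) =
          g (good_len (insert_min 0 (a # w))) + (\<Sum>k\<in>{..?n}. g (good_len (Suc a # insert_min k w)))"
        using good shift sw by (simp add: sites_Cons finite_sites)
      also have "good_len (insert_min 0 (a # w)) = Suc (Suc ?n)"
        using good_insert_front[OF Cons.prems(1,2) good]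
        by (simp add: longest_suffix_eq_length length_insert_min)
      also have "(\<Sum>k\<in>{..?n}. g (good_len (Suc a # insert_min k w))) =
          g (good_len (Suc a # insert_min m w)) + (\<Sum>k\<in>{..?n} - {m}. g (good_len (Suc a # insert_min k w)))"
        using m_le by (simp add: sum.remove[of _ m])
      also have "good_len (Suc a # insert_min m w) = Suc (Suc ?n)"
        using gm by (simp add: length_insert_min)
      also have "(\<Sum>k\<in>{..?n} - {m}. g (good_len (Suc a # insert_min k w))) =
          (\<Sum>k\<in>{..?n} - {m}. g (good_len (insert_min k w)))"
        by (rule sum.cong) (auto simp: bad)
      also have "\<dots> = (\<Sum>k\<in>{..?n}. g (good_len (insert_min k w))) - g (Suc ?n)"
        using m_le lm by (simp add: sum.remove[of _ m])
      also have "(\<Sum>k\<in>{..?n}. g (good_len (insert_min k w))) = (\<Sum>t=2..?n. g t) + 2 * g (Suc ?n)"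
        using IH Cons.prems sw lw by simp
      finally show ?thesis
        using good False by (cases w) (auto simp: algebra_simps)
    qed
  qed
qed simp

definition weight_sum :: "(nat \<Rightarrow> 'a) \<Rightarrow> nat \<Rightarrow> 'a \<Rightarrow> 'a::comm_ring_1" where
  "weight_sum g n y = (\<Sum>w\<in>av n. g (good_len w) * y ^ hd w)"

lemma active_sites_av: "w \<in> av n \<Longrightarrow> active_sites (1 # p) (1 # r) w = sites w"
  using active_sites_Cons_1[OF _ entries_gt_1] by (auto simp: sites_def)

text \<open>
  The first sum is what the succession rule would give if every insertion raised the first letter by
  one; the second sum corrects the insertions in front, whose results begin with \<open>1\<close> and are good.
\<close>

lemma weight_sum_Suc:
  fixes y :: "'a::comm_ring_1"
  assumes n: "n \<ge> 1"
  shows "weight_sum g (Suc n) y =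
    y * (\<Sum>w\<in>av n. ((\<Sum>t=2..good_len w. g t) + 2 * g (Suc (good_len w))) * y ^ hd w)
    + y * g (Suc n) * (\<Sum>w\<in>av n. of_bool (good_len w = n) * (1 - y ^ hd w))"
proof -
  have "(\<Sum>k\<in>active_sites (1 # p) (1 # r) w. g (good_len (insert_min k w)) * y ^ hd (insert_min k w)) =
      y * (((\<Sum>t=2..good_len w. g t) + 2 * g (Suc (good_len w))) * y ^ hd w)
      + y * g (Suc n) * (of_bool (good_len w = n) * (1 - y ^ hd w))" if w: "w \<in> av n" for w
  proof -
    note avD = avoidersD[OF w]
    have "w \<noteq> []" using n avD(1) by auto
    have good_iff: "good_len w = n \<longleftrightarrow> good w"
      using longest_suffix_eq_length_iff[of good w] good_short[of "[]"] avD(1) by simp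
    have hd: "hd (insert_min k w) = (if k = 0 then 1 else Suc (hd w))" for k
      using \<open>w \<noteq> []\<close> by (cases k; cases w) (auto simp: insert_min_0 insert_min_Suc_Cons)
    have "(\<Sum>k\<in>sites w. g (good_len (insert_min k w)) * y ^ hd (insert_min k w)) =
        (\<Sum>k\<in>sites w. g (good_len (insert_min k w)) * y ^ Suc (hd w)
           + (if k = 0 then g (good_len (insert_min 0 w)) * (y - y ^ Suc (hd w)) else 0))"
      by (rule sum.cong) (auto simp: hd algebra_simps)
    also have "\<dots> = (\<Sum>k\<in>sites w. g (good_len (insert_min k w))) * y ^ Suc (hd w)
        + (if 0 \<in> sites w then g (good_len (insert_min 0 w)) * (y - y ^ Suc (hd w)) else 0)"
      by (simp add: sum.distrib sum_distrib_right finite_sites)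
    also have "(if 0 \<in> sites w then g (good_len (insert_min 0 w)) * (y - y ^ Suc (hd w)) else 0) =
        g (Suc n) * (of_bool (good_len w = n) * (y - y ^ Suc (hd w)))"
      using good_insert_front[OF avD(2,4)]
      by (auto simp: good_iff sites_def longest_suffix_eq_length length_insert_min avD(1))
    finally show ?thesis
      unfolding active_sites_av[OF w] sum_insertions[OF avD(2,4) \<open>w \<noteq> []\<close>]
      by (simp add: algebra_simps)
  qed
  then show ?thesis
    unfolding weight_sum_def sum_avoiders_Suc
    by (simp add: sum.distrib sum_distrib_left)
qed

lemma av_1: "av 1 = {[1]}"
proof -
  have "good [1]" by (rule good_short) simp
  moreover have "avoids_both (1 # p) (1 # r) [1]"
    using pattern_length by (auto simp: avoids_both_def dest: contains_pattern_length)
  ultimately show ?thesis by (auto simp: avoiders_iff)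
qed

text \<open>
  With \<open>l + 1\<close> active sites the exponent \<open>j - 2\<close> is \<open>l - 1\<close>. The separate convention for \<open>n = 1\<close>
  agrees with this, as the one-letter word has \<open>l = 1\<close>.
\<close>

lemma v_poly_eq:
  fixes y q :: "'a::comm_ring_1"
  assumes n: "n \<ge> 1"
  shows "v_poly (1 # p) (1 # r) n y q = weight_sum (\<lambda>l. q ^ (l - 1)) n y"
proof -
  let ?F = "\<lambda>i. avoiders_first n i (1 # p) (1 # r)"
  have first: "v_first (1 # p) (1 # r) n i q = (\<Sum>w\<in>?F i. q ^ (good_len w - 1))" if i: "i \<in> {1..n}" for i
  proof (cases "n = 1")
    case True
    then have "?F i = {w \<in> {[1]}. w \<noteq> [] \<and> hd w = 1}"
      using i av_1 by (simp add: avoiders_first_def)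
    also have "{w \<in> {[1]}. w \<noteq> [] \<and> hd w = 1} = {[1 :: nat]}" by auto
    finally have "?F i = {[1]}" .
    then show ?thesis using True by (simp add: v_first_def)
  next
    case False
    have fin: "finite (?F i)" by (simp add: avoiders_first_def finite_avoiders)
    have w: "card (active_sites (1 # p) (1 # r) w) = Suc (good_len w)" "Suc (good_len w) \<in> {3..n+1}"
      if "w \<in> ?F i" for w
    proof -
      have "w \<in> av n" using that by (simp add: avoiders_first_def)
      then show "card (active_sites (1 # p) (1 # r) w) = Suc (good_len w)"
        using active_sites_av card_sites by metis
      show "Suc (good_len w) \<in> {3..n+1}"
        using good_len_ge[of w] longest_suffix_le[of good w] avoidersD(1)[OF \<open>w \<in> av n\<close>] False n by auto
    qed
    have "v_first (1 # p) (1 # r) n i q =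
        (\<Sum>j=3..n+1. \<Sum>w | w \<in> ?F i \<and> Suc (good_len w) = j. q ^ (good_len w - 1))"
      unfolding v_first_def u_num_def if_not_P[OF False]
    proof (rule sum.cong)
      fix j
      have "{w \<in> ?F i. card (active_sites (1 # p) (1 # r) w) = j} = {w \<in> ?F i. Suc (good_len w) = j}"
        using w(1) by (intro Collect_cong) metis
      moreover have "(\<Sum>w | w \<in> ?F i \<and> Suc (good_len w) = j. q ^ (good_len w - 1)) =
          (\<Sum>w | w \<in> ?F i \<and> Suc (good_len w) = j. q ^ (j - 2))"
        by (rule sum.cong) auto
      ultimately show "of_nat (card {w \<in> ?F i. card (active_sites (1 # p) (1 # r) w) = j}) * q ^ (j - 2) =
          (\<Sum>w | w \<in> ?F i \<and> Suc (good_len w) = j. q ^ (good_len w - 1))"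
        by simp
    qed simp
    also have "\<dots> = (\<Sum>w\<in>?F i. q ^ (good_len w - 1))"
      by (rule sum.group) (use w fin in auto)
    finally show ?thesis .
  qed
  have "v_poly (1 # p) (1 # r) n y q = (\<Sum>i=1..n. \<Sum>w | w \<in> av n \<and> hd w = i. q ^ (good_len w - 1) * y ^ hd w)"
    unfolding v_poly_def
  proof (rule sum.cong)
    fix i assume i: "i \<in> {1..n}"
    have "?F i = {w \<in> av n. hd w = i}"
      using n by (auto simp: avoiders_first_def dest: avoidersD(1))
    then show "v_first (1 # p) (1 # r) n i q * y ^ i =
        (\<Sum>w | w \<in> av n \<and> hd w = i. q ^ (good_len w - 1) * y ^ hd w)"
      by (simp add: first[OF i] sum_distrib_right del: One_nat_def)
  qed simp
  also have "\<dots> = weight_sum (\<lambda>l. q ^ (l - 1)) n y"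
    unfolding weight_sum_def
  proof (rule sum.group)
    show "hd ` av n \<subseteq> {1..n}"
    proof
      fix i assume "i \<in> hd ` av n"
      then obtain w where "w \<in> av n" "i = hd w" by auto
      then show "i \<in> {1..n}" using avoidersD(1,3)[OF \<open>w \<in> av n\<close>] n hd_in_set[of w] by fastforce
    qed
  qed (auto simp: finite_avoiders)
  finally show ?thesis .
qed

text \<open>
  The contribution of the good avoiders, which are the ones that admit an insertion in front.
\<close>

abbreviation good_sum :: "nat \<Rightarrow> 'a \<Rightarrow> 'a::comm_ring_1" where
  "good_sum n y \<equiv> weight_sum (\<lambda>l. of_bool (l = n)) n y"

lemma good_sum_1: "good_sum 1 y = y"
  unfolding weight_sum_def av_1 by (simp add: good_short)

lemma good_sum_Suc:
  fixes y :: "'a::comm_ring_1"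
  assumes "n \<ge> 1"
  shows "good_sum (Suc n) y = y * (good_sum n y + good_sum n 1)"
proof -
  have "good_len w \<le> n" if "w \<in> av n" for w
    using longest_suffix_le[of good w] avoidersD(1)[OF that] by simp
  then have "(\<Sum>w\<in>av n. ((\<Sum>t=2..good_len w. of_bool (t = Suc n)) + 2 * of_bool (Suc (good_len w) = Suc n)) * y ^ hd w) =
      (\<Sum>w\<in>av n. 2 * of_bool (good_len w = n) * y ^ hd w)"
    by (intro sum.cong refl arg_cong2[of _ _ _ _ "(*)"]) (fastforce intro!: sum.neutral)+
  then show ?thesis
    unfolding weight_sum_Suc[OF assms]
    by (simp add: weight_sum_def algebra_simps sum.distrib sum_subtractf sum_distrib_left)
qed

lemma good_sum_at_1: "good_sum (Suc n) 1 = (2 ^ n :: 'a::comm_ring_1)"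
proof (induction n)
  case 0
  show ?case using good_sum_1[of 1] by simp
next
  case (Suc n)
  then show ?case by (simp add: good_sum_Suc)
qed

text \<open>
  The succession rule sums to \<open>q + \<dots> + q^l + q^l\<close>. Multiplying by \<open>1 - q\<close> removes the geometric sum and
  leaves one term independent of \<open>l\<close>, which becomes the value at \<open>1\<close>, and one proportional to
  \<open>q ^ (l - 1)\<close>.
\<close>

lemma succession_sum:
  fixes q :: "'a::comm_ring_1"
  assumes "l \<ge> 1"
  shows "(1 - q) * ((\<Sum>t=2..l. q ^ (t - 1)) + 2 * q ^ l) = q + q * (1 - 2 * q) * q ^ (l - 1)"
proof -
  have "(1 - q) * ((\<Sum>t=2..Suc m. q ^ (t - 1)) + 2 * q ^ Suc m) = q + q * (1 - 2 * q) * q ^ m" for m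
  proof (induction m)
    case (Suc m)
    have "(\<Sum>t=2..Suc (Suc m). q ^ (t - 1)) = (\<Sum>t=2..Suc m. q ^ (t - 1)) + q ^ Suc m"
      by (subst sum.cl_ivl_Suc) simp
    then have "(1 - q) * ((\<Sum>t=2..Suc (Suc m). q ^ (t - 1)) + 2 * q ^ Suc (Suc m)) =
        (1 - q) * ((\<Sum>t=2..Suc m. q ^ (t - 1)) + 2 * q ^ Suc m)
        + (1 - q) * (2 * q ^ Suc (Suc m) - q ^ Suc m)"
      by (simp only: distrib_left right_diff_distrib) simp
    also have "\<dots> = q + q * (1 - 2 * q) * q ^ Suc m"
      unfolding Suc by (simp add: algebra_simps)
    finally show ?case .
  qed (simp add: algebra_simps)
  from this[of "l - 1"] show ?thesis using assms by simp
qed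

lemma v_poly_Suc:
  fixes y q :: "'a::comm_ring_1"
  defines "v \<equiv> \<lambda>n. v_poly (1 # p) (1 # r) (Suc n) y"
  shows "(1 - q) * v (Suc n) q =
    y * (q * v n 1 + q * (1 - 2 * q) * v n q)
    + (1 - q) * (y * q ^ Suc n * (2 ^ n - good_sum (Suc n) y))"
proof -
  let ?S = "\<Sum>w\<in>av (Suc n). ((\<Sum>t=2..good_len w. q ^ (t - 1)) + 2 * q ^ good_len w) * y ^ hd w"
  have one: "good_len w \<ge> 1" if "w \<in> av (Suc n)" for w
    using good_len_ge[of w] avoidersD(1)[OF that] by auto
  have "(1 - q) * ?S = (\<Sum>w\<in>av (Suc n). (q + q * (1 - 2 * q) * q ^ (good_len w - 1)) * y ^ hd w)"
    unfolding sum_distrib_left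
  proof (rule sum.cong)
    fix w assume "w \<in> av (Suc n)"
    show "(1 - q) * (((\<Sum>t=2..good_len w. q ^ (t - 1)) + 2 * q ^ good_len w) * y ^ hd w) =
        (q + q * (1 - 2 * q) * q ^ (good_len w - 1)) * y ^ hd w"
      unfolding succession_sum[OF one[OF \<open>w \<in> av (Suc n)\<close>], symmetric] by (rule mult.assoc[symmetric])
  qed simp
  also have "\<dots> = q * v n 1 + q * (1 - 2 * q) * v n q"
    by (simp add: v_def v_poly_eq weight_sum_def distrib_right sum.distrib sum_distrib_left mult.assoc
        del: One_nat_def)
  finally have S: "(1 - q) * ?S = q * v n 1 + q * (1 - 2 * q) * v n q" .
  have full: "(\<Sum>w\<in>av (Suc n). of_bool (good_len w = Suc n) * (1 - y ^ hd w)) = 2 ^ n - good_sum (Suc n) y"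
    unfolding good_sum_at_1[symmetric]
    by (simp add: weight_sum_def right_diff_distrib sum_subtractf)
  have "v (Suc n) q = weight_sum (\<lambda>l. q ^ (l - 1)) (Suc (Suc n)) y"
    by (simp add: v_def v_poly_eq del: One_nat_def)
  also have "\<dots> = y * ?S + y * q ^ Suc n * (2 ^ n - good_sum (Suc n) y)"
    unfolding weight_sum_Suc[of "Suc n", OF le_add1[of 1 n, unfolded plus_1_eq_Suc]] full diff_Suc_1 ..
  finally have "(1 - q) * v (Suc n) q =
      y * ((1 - q) * ?S) + (1 - q) * (y * q ^ Suc n * (2 ^ n - good_sum (Suc n) y))"
    by (simp only: distrib_left[of "1 - q"] mult.left_commute[of "1 - q" y])
  then show ?thesis by (simp only: S)
qed

end

section \<open>Unimodal and layered words\<close>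

lemma contains_pattern_triple:
  "contains_pattern w [x, y, z] \<longleftrightarrow> (\<exists>a b c. subseq [a, b, c] w \<and> order_isomorphic [a, b, c] [x, y, z])"
proof
  assume "contains_pattern w [x, y, z]"
  then obtain s where s: "subseq s w" "order_isomorphic s [x, y, z]"
    by (auto simp: contains_pattern_def)
  then have "length s = 3" by (simp add: order_isomorphic_def)
  then obtain a b c where "s = [a, b, c]"
    by (auto simp: numeral_3_eq_3 length_Suc_conv)
  with s show "\<exists>a b c. subseq [a, b, c] w \<and> order_isomorphic [a, b, c] [x, y, z]" by blast
qed (auto simp: contains_pattern_def)

lemma subseq_distinct: "subseq s w \<Longrightarrow> distinct w \<Longrightarrow> distinct s"
  by (auto simp: subseq_conv_nths)

lemma subseq_set_subset: "subseq s w \<Longrightarrow> set s \<subseteq> set w"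
  by (auto simp: subseq_conv_nths dest: in_set_nthsD)

text \<open>
  The two forbidden triples differ only in how the outer letters compare, so together they forbid every
  valley, and good words are the unimodal ones.
\<close>

lemma avoids_213_312_iff:
  assumes "distinct u"
  shows "avoids_both [3, 2, 4] [4, 2, 3] u \<longleftrightarrow> (\<forall>a b c. subseq [a, b, c] u \<longrightarrow> \<not> (b < a \<and> b < c))"
proof -
  have "order_isomorphic [a, b, c] [3, 2, 4] \<or> order_isomorphic [a, b, c] [4, 2, 3] \<longleftrightarrow> b < a \<and> b < c"
    if "subseq [a, b, c] u" for a b c
    using subseq_distinct[OF that assms] by (auto simp: order_isomorphic_Cons order_isomorphic_Nil)
  then show ?thesis
    unfolding avoids_both_def contains_pattern_triple by blast
qed

lemma avoids_231_312_iff: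
  "avoids_both [3, 4, 2] [4, 2, 3] u \<longleftrightarrow>
     (\<forall>a b c. subseq [a, b, c] u \<longrightarrow> \<not> (c < a \<and> a < b) \<and> \<not> (b < c \<and> c < a))"
proof -
  have "order_isomorphic [a, b, c] [3, 4, 2] \<longleftrightarrow> c < a \<and> a < b" for a b c
    by (auto simp: order_isomorphic_Cons order_isomorphic_Nil)
  moreover have "order_isomorphic [a, b, c] [4, 2, 3] \<longleftrightarrow> b < c \<and> c < a" for a b c
    by (auto simp: order_isomorphic_Cons order_isomorphic_Nil)
  ultimately show ?thesis
    by (simp only: avoids_both_def contains_pattern_triple) blast
qed

lemma subseq_insert_cases:
  assumes "subseq s (xs @ x # ys)"
  obtains "subseq s (xs @ ys)"
  | s1 s2 where "s = s1 @ x # s2" "subseq s1 xs" "subseq s2 ys"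
proof -
  obtain s1 s2 where s: "s = s1 @ s2" "subseq s1 xs" "subseq s2 (x # ys)"
    using assms by (auto simp: subseq_append_iff)
  show thesis
  proof (cases "subseq s2 ys")
    case True
    then show ?thesis using that(1) s list_emb_append_mono by blast
  next
    case False
    then obtain s2' where "s2 = x # s2'" "subseq s2' ys"
      using s(3) by (cases s2) (auto split: if_splits)
    then show ?thesis using that(2) s by blast
  qed
qed

lemma subseq_triple_insert_min:
  "subseq [a, b, c] (insert_min k u) \<longleftrightarrow>
     subseq [a, b, c] (map Suc u)
     \<or> a = 1 \<and> subseq [b, c] (map Suc (drop k u))
     \<or> b = 1 \<and> a \<in> Suc ` set (take k u) \<and> c \<in> Suc ` set (drop k u)
     \<or> c = 1 \<and> subseq [a, b] (map Suc (take k u))" (is "?L \<longleftrightarrow> ?R")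
proof
  let ?l = "map Suc (take k u)" and ?r = "map Suc (drop k u)"
  have u: "map Suc u = ?l @ ?r" by (simp flip: map_append)
  have ins: "insert_min k u = ?l @ 1 # ?r" by (simp add: insert_min_def take_map drop_map)
  show ?R if ?L
    using that unfolding ins
  proof (cases rule: subseq_insert_cases)
    case (2 s1 s2)
    then show ?thesis
      by (auto simp: Cons_eq_append_conv subseq_singleton_left simp flip: set_map)
  qed (simp add: u)
  show ?L if ?R
    using that
  proof (elim disjE conjE)
    assume "subseq [a, b, c] (map Suc u)"
    then show ?L using subseq_insert_min subseq_order.order_trans by blast
  next
    assume "a = 1" "subseq [b, c] ?r"
    then show ?L unfolding ins by (intro list_emb_append2) simp
  next
    assume "b = 1" "a \<in> Suc ` set (take k u)" "c \<in> Suc ` set (drop k u)"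
    then have "subseq ([a] @ 1 # [c]) (?l @ 1 # ?r)"
      by (intro list_emb_append_mono subseq_Cons2) (auto simp: subseq_singleton_left)
    then show ?L unfolding ins \<open>b = 1\<close> by simp
  next
    assume "c = 1" "subseq [a, b] ?l"
    then have "subseq ([a, b] @ [1]) (?l @ 1 # ?r)"
      by (intro list_emb_append_mono) auto
    then show ?L unfolding ins \<open>c = 1\<close> by simp
  qed
qed

lemma avoids_both_map_Suc: "avoids_both p r (map Suc u) \<longleftrightarrow> avoids_both p r u"
  by (simp add: avoids_both_def contains_pattern_map_Suc)

lemma distinct_insert_min:
  assumes "distinct u" "0 \<notin> set u"
  shows "distinct (insert_min k u)"
proof -
  have "distinct (map Suc (take k u) @ map Suc (drop k u))"
    using assms(1) by (simp flip: map_append add: distinct_map)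
  then show ?thesis
    using assms(2) by (auto simp: insert_min_def take_map drop_map dest: in_set_takeD in_set_dropD)
qed

text \<open>
  Anywhere but at the ends the minimum would create a valley.
\<close>

lemma avoids_213_312_insert_min:
  assumes "distinct u" "0 \<notin> set u" "avoids_both [3, 2, 4] [4, 2, 3] u"
  shows "avoids_both [3, 2, 4] [4, 2, 3] (insert_min k u) \<longleftrightarrow> k = 0 \<or> length u \<le> k"
proof -
  have old: "\<not> (b < a \<and> b < c)" if "subseq [a, b, c] (map Suc u)" for a b c
    using assms that avoids_213_312_iff[of "map Suc u"] by (simp add: avoids_both_map_Suc distinct_map)
  have pos: "1 < a" if "a \<in> Suc ` set u" for a
    using that assms(2) by (cases "a - 1") auto
  have "avoids_both [3, 2, 4] [4, 2, 3] (insert_min k u) \<longleftrightarrow> take k u = [] \<or> drop k u = []"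
  proof
    assume good: "avoids_both [3, 2, 4] [4, 2, 3] (insert_min k u)"
    show "take k u = [] \<or> drop k u = []"
    proof (rule ccontr)
      assume "\<not> (take k u = [] \<or> drop k u = [])"
      then obtain a c where ac: "a \<in> set (take k u)" "c \<in> set (drop k u)"
        by (metis list.set_intros(1) neq_Nil_conv)
      then have "subseq [Suc a, 1, Suc c] (insert_min k u)"
        unfolding subseq_triple_insert_min by blast
      moreover have "1 < Suc a" "1 < Suc c"
        using ac pos by (blast dest: in_set_takeD in_set_dropD)+
      ultimately show False
        using good avoids_213_312_iff[OF distinct_insert_min[OF assms(1,2)]] by blast
    qed
  next
    assume nil: "take k u = [] \<or> drop k u = []"
    have "\<not> (b < a \<and> b < c)" if "subseq [a, b, c] (insert_min k u)" for a b c
      using that unfolding subseq_triple_insert_min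
    proof (elim disjE conjE)
      assume "a = 1" and bc: "subseq [b, c] (map Suc (drop k u))"
      have "b \<in> Suc ` set (drop k u)" using subseq_set_subset[OF bc] by simp
      then have "b \<in> Suc ` set u" by (blast dest: in_set_dropD)
      then show ?thesis using pos \<open>a = 1\<close> by fastforce
    next
      assume "c = 1" and ab: "subseq [a, b] (map Suc (take k u))"
      have "b \<in> Suc ` set (take k u)" using subseq_set_subset[OF ab] by simp
      then have "b \<in> Suc ` set u" by (blast dest: in_set_takeD)
      then show ?thesis using pos \<open>c = 1\<close> by fastforce
    next
      assume "subseq [a, b, c] (map Suc u)"
      then show ?thesis by (rule old)
    qed (use nil in auto)
    then show "avoids_both [3, 2, 4] [4, 2, 3] (insert_min k u)"
      using avoids_213_312_iff[OF distinct_insert_min[OF assms(1,2)]] by blast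
  qed
  then show ?thesis by auto
qed

text \<open>
  As the last letter of a bad triple the minimum is excluded by a decreasing left part; as the middle
  letter it is excluded if no letter on the right is smaller than one on the left; it is never the
  first letter of a bad triple.
\<close>

lemma avoids_231_312_insert_min:
  assumes "0 \<notin> set u" "avoids_both [3, 4, 2] [4, 2, 3] u"
  shows "avoids_both [3, 4, 2] [4, 2, 3] (insert_min k u) \<longleftrightarrow>
    (\<forall>a b. subseq [a, b] (take k u) \<longrightarrow> \<not> a < b) \<and>
    (\<forall>a\<in>set (take k u). \<forall>c\<in>set (drop k u). \<not> c < a)" (is "?L \<longleftrightarrow> ?R")
proof -
  have old: "\<not> (c < a \<and> a < b) \<and> \<not> (b < c \<and> c < a)" if "subseq [a, b, c] (map Suc u)" for a b c
    using assms(2) that unfolding avoids_both_map_Suc[symmetric, of _ _ u] avoids_231_312_iff by blast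
  have pos: "0 < a" if "a \<in> set u" for a
    using that assms(1) gr0I by metis
  have sub: "\<exists>a' b'. a = Suc a' \<and> b = Suc b' \<and> subseq [a', b'] v" if "subseq [a, b] (map Suc v)" for a b v
    using that by (auto simp: subseq_conv_nths nths_map Cons_eq_map_conv) metis
  show ?thesis
  proof
    assume ?L
    then have good: "\<not> (c < a \<and> a < b) \<and> \<not> (b < c \<and> c < a)" if "subseq [a, b, c] (insert_min k u)" for a b c
      using that unfolding avoids_231_312_iff by blast
    show ?R
    proof (intro conjI allI impI ballI)
      fix a b assume ab: "subseq [a, b] (take k u)"
      then have "subseq [Suc a, Suc b, 1] (insert_min k u)"
        unfolding subseq_triple_insert_min using subseq_map[OF ab, of Suc] by simp
      moreover have "a \<in> set u"
        using subseq_set_subset[OF ab] by (auto dest: in_set_takeD)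
      then have "0 < a" by (rule pos)
      ultimately show "\<not> a < b"
        using good[of "Suc a" "Suc b" 1] by simp
    next
      fix a c assume ac: "a \<in> set (take k u)" "c \<in> set (drop k u)"
      then have "subseq [Suc a, 1, Suc c] (insert_min k u)"
        unfolding subseq_triple_insert_min by blast
      moreover have "0 < c"
        using ac pos by (auto dest: in_set_dropD)
      ultimately show "\<not> c < a"
        using good[of "Suc a" 1 "Suc c"] by simp
    qed
  next
    assume R: ?R
    have "\<not> (c < a \<and> a < b) \<and> \<not> (b < c \<and> c < a)" if "subseq [a, b, c] (insert_min k u)" for a b c
      using that unfolding subseq_triple_insert_min
    proof (elim disjE conjE)
      assume "a = 1" and bc: "subseq [b, c] (map Suc (drop k u))"
      obtain c' where "c = Suc c'" using sub[OF bc] by blast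
      then show ?thesis using \<open>a = 1\<close> by simp
    next
      assume "c = 1" and ab: "subseq [a, b] (map Suc (take k u))"
      obtain a' b' where "a = Suc a'" "b = Suc b'" "subseq [a', b'] (take k u)"
        using sub[OF ab] by blast
      moreover from this R have "\<not> a' < b'" by blast
      ultimately show ?thesis using \<open>c = 1\<close> by simp
    next
      assume "subseq [a, b, c] (map Suc u)"
      then show ?thesis by (rule old)
    next
      assume "b = 1" "a \<in> Suc ` set (take k u)" "c \<in> Suc ` set (drop k u)"
      then obtain a' c' where ac: "a = Suc a'" "c = Suc c'" "a' \<in> set (take k u)" "c' \<in> set (drop k u)"
        by blast
      with R have "\<not> c' < a'" by blast
      then show ?thesis using \<open>b = 1\<close> ac(1,2) by simp
    qed
    then show ?L unfolding avoids_231_312_iff by blast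
  qed
qed

lemma min_insertion_213_312: "min_insertion [3, 2, 4] [4, 2, 3]"
proof
  fix u :: "nat list"
  assume u: "distinct u" "0 \<notin> set u" "avoids_both [3, 2, 4] [4, 2, 3] u"
  show "avoids_both [3, 2, 4] [4, 2, 3] (insert_min 0 u)"
    by (simp add: avoids_213_312_insert_min[OF u])
  show "\<exists>!k. 0 < k \<and> k \<le> length u \<and> avoids_both [3, 2, 4] [4, 2, 3] (insert_min k u)" if "u \<noteq> []"
    using that by (intro ex1I[of _ "length u"]) (auto simp: avoids_213_312_insert_min[OF u])
qed auto

text \<open>
  A good word is a sequence of decreasing layers, each lying above the previous one. By the criterion
  above the further good position is the end of the first layer, which consists of the initial letters
  that do not exceed the first letter.
\<close>

lemma min_insertion_231_312: "min_insertion [3, 4, 2] [4, 2, 3]"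
proof
  fix u :: "nat list"
  assume u: "distinct u" "0 \<notin> set u" "avoids_both [3, 4, 2] [4, 2, 3] u"
  note crit = avoids_231_312_insert_min[OF u(2,3)]
  show "avoids_both [3, 4, 2] [4, 2, 3] (insert_min 0 u)"
    by (simp add: crit)
  assume "u \<noteq> []"
  then obtain a v where av: "u = a # v" by (cases u) auto
  have no: "\<not> (z < x \<and> x < y) \<and> \<not> (y < z \<and> z < x)" if "subseq [x, y, z] u" for x y z
    using u(3) that unfolding avoids_231_312_iff by blast
  define k where "k = length (takeWhile (\<lambda>x. x \<le> a) u)"
  have k: "take k u = takeWhile (\<lambda>x. x \<le> a) u" "drop k u = dropWhile (\<lambda>x. x \<le> a) u"
    unfolding k_def by (rule takeWhile_eq_take[symmetric], rule dropWhile_eq_drop[symmetric])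
  have tk: "take k u = a # takeWhile (\<lambda>x. x \<le> a) v" and dk: "drop k u = dropWhile (\<lambda>x. x \<le> a) v"
    unfolding k by (simp_all add: av)
  have "0 < k" "k \<le> length u"
    by (simp_all add: k_def length_takeWhile_le) (simp add: av)
  moreover have "\<not> x < y" if "subseq [x, y] (take k u)" for x y
  proof (cases "x = a")
    case True
    have "y \<in> set (take k u)" using subseq_set_subset[OF that] by auto
    then show ?thesis using True unfolding k by (auto dest: set_takeWhileD)
  next
    case False
    then have sub: "subseq [x, y] (takeWhile (\<lambda>x. x \<le> a) v)"
      using that by (simp add: tk)
    then have "subseq [x, y] v"
      by (metis subseq_rev_drop_many takeWhile_dropWhile_id)
    then have "subseq [a, x, y] u" by (simp add: av)
    moreover have "y \<le> a" "y \<in> set v"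
      using subseq_set_subset[OF sub] by (auto dest: set_takeWhileD)
    moreover have "y \<noteq> a" using u(1) av \<open>y \<in> set v\<close> by auto
    ultimately show ?thesis using no[of a x y] by linarith
  qed
  moreover have "\<not> z < x" if x: "x \<in> set (take k u)" and z: "z \<in> set (drop k u)" for x z
  proof -
    have "x \<le> a" using x unfolding k by (auto dest: set_takeWhileD)
    obtain b w where bw: "dropWhile (\<lambda>x. x \<le> a) v = b # w" "a < b"
      using z unfolding dk
      by (metis dropWhile_eq_Cons_conv empty_iff empty_set linorder_not_le neq_Nil_conv)
    have "a < z"
    proof (cases "z = b")
      case False
      then have "z \<in> set w" using z dk bw by simp
      then have "subseq [b, z] (dropWhile (\<lambda>x. x \<le> a) v)"
        by (simp add: bw subseq_singleton_left)
      then have "subseq [b, z] v"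
        by (metis subseq_drop_many takeWhile_dropWhile_id)
      then have "subseq [a, b, z] u" by (simp add: av)
      moreover have "z \<in> set v" using z dk by (auto dest: set_dropWhileD)
      then have "z \<noteq> a" using u(1) av by auto
      ultimately show ?thesis using no[of a b z] bw(2) by linarith
    qed (use bw in simp)
    then show ?thesis using \<open>x \<le> a\<close> by simp
  qed
  ultimately have ex: "0 < k \<and> k \<le> length u \<and> avoids_both [3, 4, 2] [4, 2, 3] (insert_min k u)"
    unfolding crit by blast
  \<comment> \<open>the letter \<open>e\<close> just after position \<open>i\<close> exceeds the first letter \<open>a\<close> by the criterion at \<open>i\<close>, and not by the criterion at \<open>j\<close>\<close>
  have no_two: False
    if bounds: "0 < i" "i < j" "j \<le> length u"
      and i: "avoids_both [3, 4, 2] [4, 2, 3] (insert_min i u)"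
      and j: "avoids_both [3, 4, 2] [4, 2, 3] (insert_min j u)" for i j
  proof -
    obtain i' j' where ij: "i = Suc i'" "j = Suc j'" "i' < j'" "j' \<le> length v"
      using bounds av by (cases i; cases j) auto
    define e where "e = v ! i'"
    have "e \<in> set (take j' v)"
      using ij unfolding e_def by (metis in_set_conv_nth length_take min.absorb2 nth_take)
    then have "subseq [a, e] (take j u)"
      by (simp add: ij av subseq_singleton_left)
    then have "\<not> a < e" using j unfolding crit by blast
    moreover have "drop i u = e # drop (Suc i') v"
      using ij by (simp add: e_def av Cons_nth_drop_Suc)
    then have "\<not> e < a" using i unfolding crit by (simp add: ij av)
    moreover have "e \<noteq> a" using u(1) av \<open>e \<in> set (take j' v)\<close> by (auto dest: in_set_takeD)
    ultimately show False by simp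
  qed
  show "\<exists>!k. 0 < k \<and> k \<le> length u \<and> avoids_both [3, 4, 2] [4, 2, 3] (insert_min k u)"
    using ex no_two by (metis linorder_neqE_nat)
qed auto

section \<open>Power series with power series coefficients\<close>

text \<open>
  The sum of \<open>p k * X ^ k\<close>, for coefficients that may themselves be power series in \<open>X\<close>. It makes sense
  of substituting a power series in \<open>X\<close> for the variable \<open>q\<close> of the generating function, as the kernel
  method requires. Linearity and the shift rule suffice to translate recurrences.
\<close>

definition X_sum :: "(nat \<Rightarrow> 'a::comm_ring_1 fps) \<Rightarrow> 'a fps" where
  "X_sum p = Abs_fps (\<lambda>n. \<Sum>k\<le>n. p k $ (n - k))"

lemma X_sum_nth: "n \<le> N \<Longrightarrow> X_sum p $ n = (\<Sum>k\<le>N. fps_X ^ k * p k) $ n"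
proof -
  assume "n \<le> N"
  then have "(\<Sum>k\<le>n. p k $ (n - k)) = (\<Sum>k\<le>N. if n < k then 0 else p k $ (n - k))"
    by (intro sum.mono_neutral_cong_left) auto
  then show ?thesis
    by (simp add: X_sum_def fps_sum_nth fps_X_power_mult_nth)
qed

lemma X_sum_shift: "X_sum p = p 0 + fps_X * X_sum (\<lambda>n. p (Suc n))"
proof (rule fps_ext)
  fix n
  show "X_sum p $ n = (p 0 + fps_X * X_sum (\<lambda>n. p (Suc n))) $ n"
    by (cases n) (simp_all add: X_sum_def sum.atMost_Suc_shift del: sum.atMost_Suc)
qed

lemma X_sum_add: "X_sum (\<lambda>n. p n + r n) = X_sum p + X_sum r"
  by (rule fps_ext) (simp add: X_sum_def sum.distrib)

lemma X_sum_mult: "X_sum (\<lambda>n. c * p n) = c * X_sum p"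
proof (rule fps_ext)
  fix n
  have "(c * X_sum p) $ n = (\<Sum>i=0..n. c $ i * (\<Sum>k\<le>n. fps_X ^ k * p k) $ (n - i))"
    unfolding fps_mult_nth by (intro sum.cong refl arg_cong2[of _ _ _ _ "(*)"] X_sum_nth) simp
  also have "\<dots> = (c * (\<Sum>k\<le>n. fps_X ^ k * p k)) $ n"
    by (rule fps_mult_nth[symmetric])
  also have "\<dots> = (\<Sum>k\<le>n. fps_X ^ k * (c * p k)) $ n"
    by (simp add: sum_distrib_left mult.left_commute)
  also have "\<dots> = X_sum (\<lambda>n. c * p n) $ n"
    by (rule X_sum_nth[symmetric]) simp
  finally show "X_sum (\<lambda>n. c * p n) $ n = (c * X_sum p) $ n" ..
qed

lemma X_sum_const: "X_sum (\<lambda>n. fps_const (c n)) = Abs_fps c"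
proof (rule fps_ext)
  fix n
  have "(\<Sum>k\<le>n. if n - k = 0 then c k else 0) = (\<Sum>k\<le>n. if k = n then c k else 0)"
    by (rule sum.cong) auto
  then show "X_sum (\<lambda>n. fps_const (c n)) $ n = Abs_fps c $ n"
    by (simp add: X_sum_def)
qed

section \<open>The functional equation and the kernel method\<close>

lemma fps_const_sum: "fps_const (sum f A) = (\<Sum>x\<in>A. fps_const (f x))"
  by (induction A rule: infinite_finite_induct) (auto simp flip: fps_const_add)

lemma v_poly_fps_const:
  "v_poly \<sigma> \<tau> n (fps_const b) (fps_const c) = fps_const (v_poly \<sigma> \<tau> n b c)"
proof -
  have "v_first \<sigma> \<tau> n i (fps_const c) = fps_const (v_first \<sigma> \<tau> n i c)" for i
    by (simp add: v_first_def fps_const_sum del: sum.cl_ivl_Suc flip: fps_of_nat)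
  then show ?thesis by (simp add: v_poly_def fps_const_sum)
qed

text \<open>
  The generating function divided by \<open>x\<close>, with power series allowed for \<open>y\<close> and \<open>q\<close>.
\<close>

definition shifted_gf :: "nat list \<Rightarrow> nat list \<Rightarrow> 'a fps \<Rightarrow> 'a fps \<Rightarrow> 'a::comm_ring_1 fps" where
  "shifted_gf \<sigma> \<tau> y q = X_sum (\<lambda>n. v_poly \<sigma> \<tau> (Suc n) y q)"

lemma joint_gf_eq:
  "joint_gf \<sigma> \<tau> b c = fps_X * shifted_gf \<sigma> \<tau> (fps_const b) (fps_const c)"
  unfolding shifted_gf_def v_poly_fps_const X_sum_const
  by (rule fps_ext) (simp add: joint_gf_def)

context min_insertion
begin

text \<open>
  \<open>H\<close> collects the numbers \<open>2 ^ n\<close> of good avoiders of length \<open>n + 1\<close>, and \<open>G\<close> weights them by their first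
  letter. Both satisfy linear equations and are eliminated at the end, which is where the factors
  \<open>1 - 2xq\<close> and \<open>1 - xyq\<close> come from.
\<close>

lemma functional_equation:
  fixes y q :: "'a::comm_ring_1 fps"
  defines "x \<equiv> fps_X :: 'a fps" and "F \<equiv> shifted_gf (1 # p) (1 # r) y"
  shows "(1 - 2 * x * q) * (1 - x * y * q)
      * ((1 - (x * y + 1) * q + 2 * x * y * q ^ 2) * F q - x * y * q * F 1) =
    y * (1 - q) * (1 - x * q) * (1 - 2 * x * y * q)"
proof -
  define H where "H = X_sum (\<lambda>n. q ^ n * 2 ^ n)"
  define G where "G = X_sum (\<lambda>n. q ^ n * good_sum (Suc n) y)"
  have H: "H = 1 + x * (2 * q * H)"
  proof -
    have "H = 1 + x * X_sum (\<lambda>n. 2 * q * (q ^ n * 2 ^ n))"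
      unfolding H_def by (subst X_sum_shift) (simp add: x_def mult_ac)
    then show ?thesis unfolding X_sum_mult H_def .
  qed
  have G: "G = y + x * (q * y * (G + H))"
  proof -
    have "(\<lambda>n. q ^ Suc n * good_sum (Suc (Suc n)) y) =
        (\<lambda>n. q * y * (q ^ n * good_sum (Suc n) y + q ^ n * 2 ^ n))"
      by (rule ext) (simp add: good_sum_Suc good_sum_at_1 algebra_simps)
    then have "G = y + x * X_sum (\<lambda>n. q * y * (q ^ n * good_sum (Suc n) y + q ^ n * 2 ^ n))"
      unfolding G_def using good_sum_1[of y] by (subst X_sum_shift) (simp add: x_def)
    then show ?thesis unfolding X_sum_mult X_sum_add G_def H_def .
  qed
  have v1: "v_poly (1 # p) (1 # r) 1 y q = y"
    unfolding v_poly_eq[OF order_refl] weight_sum_def av_1 by (simp add: good_short)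
  have F: "(1 - q) * F q = (1 - q) * y
      + x * (y * q * F 1 + y * q * (1 - 2 * q) * F q + ((1 - q) * y * q * H + - ((1 - q) * y * q) * G))"
  proof -
    let ?v = "\<lambda>n. v_poly (1 # p) (1 # r) (Suc n) y"
    have "(\<lambda>n. (1 - q) * ?v (Suc n) q) = (\<lambda>n. y * q * ?v n 1 + y * q * (1 - 2 * q) * ?v n q
        + ((1 - q) * y * q * (q ^ n * 2 ^ n) + - ((1 - q) * y * q) * (q ^ n * good_sum (Suc n) y)))"
      unfolding v_poly_Suc by (rule ext) (simp add: algebra_simps)
    moreover have "(1 - q) * F q = (1 - q) * y + x * X_sum (\<lambda>n. (1 - q) * ?v (Suc n) q)"
      unfolding F_def shifted_gf_def X_sum_mult[of "1 - q", symmetric] x_def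
      by (subst X_sum_shift) (use v1 in simp)
    ultimately show ?thesis
      by (simp only: X_sum_add X_sum_mult F_def shifted_gf_def H_def G_def)
  qed
  have H': "(1 - 2 * x * q) * H = 1"
  proof -
    have "(1 - 2 * x * q) * H = H - x * (2 * q * H)" by (simp add: algebra_simps)
    also have "\<dots> = 1" using H by (simp only: diff_eq_eq)
    finally show ?thesis .
  qed
  have G': "(1 - x * y * q) * G = y + x * y * q * H"
  proof -
    have "(1 - x * y * q) * G = (G - x * (q * y * (G + H))) + x * y * q * H"
      by (simp add: algebra_simps)
    also have "G - x * (q * y * (G + H)) = y" using G by (simp only: diff_eq_eq)
    finally show ?thesis .
  qed
  have "(1 - (x * y + 1) * q + 2 * x * y * q ^ 2) * F q - x * y * q * F 1 =
      (1 - q) * F q - x * (y * q * F 1 + y * q * (1 - 2 * q) * F q)"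
    by (simp add: algebra_simps power2_eq_square)
  also have "\<dots> = (1 - q) * y + x * ((1 - q) * y * q * H + - ((1 - q) * y * q) * G)"
    using F by (simp only: diff_eq_eq distrib_left add.assoc add.commute add.left_commute)
  also have "\<dots> = y * (1 - q) * (1 + x * q * (H - G))"
    by (simp add: algebra_simps)
  finally have K: "(1 - (x * y + 1) * q + 2 * x * y * q ^ 2) * F q - x * y * q * F 1 =
      y * (1 - q) * (1 + x * q * (H - G))" .
  have "(1 - 2 * x * q) * (1 - x * y * q) * (1 + x * q * (H - G)) =
      (1 - 2 * x * q) * (1 - x * y * q)
      + x * q * ((1 - x * y * q) * ((1 - 2 * x * q) * H) - (1 - 2 * x * q) * ((1 - x * y * q) * G))"
    by (simp add: algebra_simps)
  also have "\<dots> = (1 - 2 * x * q) * (1 - x * y * q)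
      + x * q * ((1 - x * y * q) * ((1 - 2 * x * q) * H) - (1 - 2 * x * q) * y
          - x * y * q * ((1 - 2 * x * q) * H))"
    unfolding G' by (simp add: algebra_simps)
  also have "\<dots> = (1 - x * q) * (1 - 2 * x * y * q)"
    unfolding H' by (simp add: algebra_simps)
  finally have M: "(1 - 2 * x * q) * (1 - x * y * q) * (1 + x * q * (H - G)) =
      (1 - x * q) * (1 - 2 * x * y * q)" .
  have "(1 - 2 * x * q) * (1 - x * y * q) * (y * (1 - q) * (1 + x * q * (H - G))) =
      y * (1 - q) * ((1 - 2 * x * q) * (1 - x * y * q) * (1 + x * q * (H - G)))"
    by (simp only: mult_ac)
  then show ?thesis unfolding K M by (simp only: mult.assoc)
qed

text \<open>
  The kernel method. At the root \<open>q\<close> of the kernel that is a power series, the functional equation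
  reduces to a linear equation for the value at \<open>1\<close>.
\<close>

lemma shifted_gf_at_1:
  fixes b :: "'a::field_char_0"
  defines "x \<equiv> fps_X :: 'a fps" and "y \<equiv> fps_const b"
  assumes b: "b \<noteq> 0" "b \<noteq> 1"
  shows "x * shifted_gf (1 # p) (1 # r) y 1 = A_gf x y"
proof -
  define s where "s = fps_sqrt1 (1 - 6 * x * y + x ^ 2 * y ^ 2)"
  have s: "s ^ 2 = 1 - 6 * x * y + x ^ 2 * y ^ 2" "s $ 0 = 1"
    using fps_sqrt1_unique[of "1 - 6 * x * y + x ^ 2 * y ^ 2" s] by (simp_all add: s_def x_def y_def)
  define u where "u = 1 + x * y + s"
  have u0: "u $ 0 = 2" by (simp add: u_def s x_def)
  define q where "q = 2 * inverse u"
  have qu: "q * u = 2"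
    using inverse_mult_eq_1[of u] u0 by (simp add: q_def mult.assoc)
  have "u \<noteq> 0" using u0 by auto
  \<comment> \<open>with \<open>s\<close> expressed through \<open>q\<close>, only the kernel relation remains between \<open>x\<close>, \<open>y\<close>, \<open>q\<close>\<close>
  have "u * (s - (1 + x * y - 4 * x * y * q)) = s ^ 2 - (1 + x * y) ^ 2 + 4 * x * y * (q * u)"
    by (simp add: u_def algebra_simps power2_eq_square)
  also have "\<dots> = 0"
    unfolding qu s(1) by (simp add: algebra_simps power2_eq_square)
  finally have s_eq: "s = 1 + x * y - 4 * x * y * q"
    using \<open>u \<noteq> 0\<close> by simp
  have kernel: "1 - (x * y + 1) * q + 2 * x * y * q ^ 2 = 0"
  proof -
    have "2 * (1 - (x * y + 1) * q + 2 * x * y * q ^ 2) = 2 - q * u"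
      unfolding u_def s_eq by (simp add: algebra_simps power2_eq_square)
    also have "\<dots> = 0" unfolding qu by simp
    finally show ?thesis by (metis mult_eq_0_iff zero_neq_numeral)
  qed
  define f where "f = x * shifted_gf (1 # p) (1 # r) y 1"
  let ?P = "q * (1 - 2 * x * q) * (1 - x * y * q)"
  have "y * (f * ?P + (1 - q) * (1 - x * q) * (1 - 2 * x * y * q)) = 0"
    using functional_equation[of q y] unfolding kernel[unfolded x_def] x_def f_def by algebra
  moreover have "y \<noteq> 0" using b by (simp add: y_def)
  ultimately have f: "f * ?P = - (1 - q) * (1 - x * q) * (1 - 2 * x * y * q)"
    by algebra
  let ?N = "x * y * (2 - 3 * x - 3 * y + 3 * x * y) + x * y * (x + y - x * y) * (x * y + s)"
  let ?D = "2 * (1 - 2 * x - y + x * y)"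
  \<comment> \<open>the claimed value and the one just found, cross-multiplied, differ by \<open>?C\<close> times the kernel, as polynomials in \<open>q\<close>\<close>
  let ?C = "2 - 2 * y - 4 * x + 2 * x * y
      + (2 * x * y - 2 * x + 4 * x ^ 2 + 2 * x ^ 2 * y ^ 3 + 2 * x ^ 3 * y ^ 2 - 2 * x ^ 3 * y ^ 3) * q
      + (4 * x ^ 4 * y ^ 3 - 4 * x ^ 3 * y ^ 3 - 4 * x ^ 4 * y ^ 2) * q ^ 2"
  have "?N * ?P + ?D * ((1 - q) * (1 - x * q) * (1 - 2 * x * y * q)) =
      ?C * (1 - (x * y + 1) * q + 2 * x * y * q ^ 2)"
    unfolding s_eq by algebra
  also have "\<dots> = 0"
    by (simp only: kernel mult_zero_right)
  finally have "?P * (f * ?D - ?N) = 0"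
    using f by algebra
  moreover have "?P $ 0 \<noteq> 0"
    using u0 by (simp add: q_def x_def)
  then have "?P \<noteq> 0" by (metis fps_zero_nth)
  ultimately have "f * ?D = ?N" by simp
  moreover have D0: "?D $ 0 \<noteq> 0" using b by (simp add: x_def y_def)
  then have "?D \<noteq> 0" by (metis fps_zero_nth)
  ultimately show ?thesis
    unfolding A_gf_def f_def[symmetric] s_def[symmetric] by (metis nonzero_mult_div_cancel_right)
qed

lemma joint_gf_formula:
  fixes b c :: "'a::field_char_0"
  defines "x \<equiv> fps_X :: 'a fps" and "y \<equiv> fps_const b" and "q \<equiv> fps_const c"
  assumes "b \<noteq> 0" "b \<noteq> 1" "c \<noteq> 1"
  shows "joint_gf (1 # p) (1 # r) b c =
      x * y * (1 - q) * (1 - x * q) * (1 - 2 * x * y * q)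
        / ((1 - 2 * x * q) * (1 - x * y * q) * (1 - (x * y + 1) * q + 2 * x * y * q ^ 2))
      + x * y * q / (1 - (x * y + 1) * q + 2 * x * y * q ^ 2) * A_gf x y"
proof -
  let ?M = "(1 - 2 * x * q) * (1 - x * y * q)" and ?K = "1 - (x * y + 1) * q + 2 * x * y * q ^ 2"
  let ?N = "x * y * (1 - q) * (1 - x * q) * (1 - 2 * x * y * q)"
  define f where "f = joint_gf (1 # p) (1 # r) b c"
  have f: "f = x * shifted_gf (1 # p) (1 # r) y q"
    by (simp add: f_def joint_gf_eq x_def y_def q_def)
  have A: "A_gf x y = x * shifted_gf (1 # p) (1 # r) y 1"
    using shifted_gf_at_1[OF assms(4,5)] by (simp add: x_def y_def)
  have pull_out: "m * (k * (x * g) - t * (x * h)) = x * (m * (k * g - t * h))" for m k g t h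
    by (simp add: algebra_simps)
  have eq: "?M * (?K * f - x * y * q * A_gf x y) = ?N"
    unfolding f A pull_out functional_equation[of q y, folded x_def] by (simp only: mult.assoc)
  have M: "inverse ?M * ?M = 1" and K: "inverse ?K * ?K = 1" and K0: "?K $ 0 \<noteq> 0"
    and MK0: "(?M * ?K) $ 0 \<noteq> 0"
    using assms(6) by (auto intro!: inverse_mult_eq_1 simp: x_def y_def q_def)
  have "?N / (?M * ?K) + x * y * q / ?K * A_gf x y =
      ?N * (inverse ?M * inverse ?K) + x * y * q * inverse ?K * A_gf x y"
    by (simp only: fps_divide_unit[OF K0] fps_divide_unit[OF MK0] fps_inverse_mult)
  also have "\<dots> = (?M * (?K * f - x * y * q * A_gf x y)) * (inverse ?M * inverse ?K)
      + x * y * q * inverse ?K * A_gf x y"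
    by (simp only: eq)
  also have "\<dots> = (inverse ?M * ?M) * ((inverse ?K * ?K) * f - x * y * q * inverse ?K * A_gf x y)
      + x * y * q * inverse ?K * A_gf x y"
  proof -
    have "(m * (k * g - w * a)) * (m' * k') + w * k' * a = (m' * m) * ((k' * k) * g - w * k' * a) + w * k' * a"
      for m k m' k' w a g :: "'a fps"
      by (simp add: algebra_simps)
    then show ?thesis .
  qed
  also have "\<dots> = f"
    unfolding M K by simp
  finally show ?thesis unfolding f_def ..
qed

end

theorem theorem6:
  fixes \<sigma> \<tau> :: "nat list"
  assumes "(\<sigma>, \<tau>) = ([1,3,2,4], [1,4,2,3]) \<or> (\<sigma>, \<tau>) = ([1,3,4,2], [1,4,2,3])"
  shows "let x = (fps_X :: ratfun2 fps); y = fps_const y_var; q = fps_const q_var in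
    joint_gf \<sigma> \<tau> y_var q_var =
      x * y * (1 - q) * (1 - x * q) * (1 - 2 * x * y * q)
        / ((1 - 2 * x * q) * (1 - x * y * q) * (1 - (x * y + 1) * q + 2 * x * y * q ^ 2))
      + x * y * q / (1 - (x * y + 1) * q + 2 * x * y * q ^ 2) * A_gf x y"
proof -
  have nz: "y_var \<noteq> 0" "y_var \<noteq> 1" "q_var \<noteq> 1"
    using one_minus_vars_nonzero
    by (auto simp: y_var_def Zero_fract_def eq_fract)
  show ?thesis
    using assms min_insertion.joint_gf_formula[OF min_insertion_213_312 nz]
      min_insertion.joint_gf_formula[OF min_insertion_231_312 nz]
    unfolding Let_def by blast
qed

end
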